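(* Let $A$ be a finite alphabet with $|A|\ge2$, let $\mathcal P$ be the set of stationary ergodic probability measures on $A^{\mathbb Z}$, let $\mathcal P_f\subset\mathcal P$ be the subset of measures whose context tree is finite, and let $\mathcal T$ be the set of irreducible trees on $A$ with the partial order $\preceq$. Let $n\ge1$ and let $U_n\colon A^n\to\mathcal T$ be a statistic such that $$\sup_{P\in\mathcal P}P\bigl(U_n(X_1,\dots,X_n)\prec\tau^\infty\bigr)=1 .$$ Then $$\inf_{P\in\mathcal P}P\bigl(\tau_P\preceq U_n(X_1,\dots,X_n)\bigr)=0,$$ and the same holds on the smaller class $\mathcal P_f$, i.e. $\inf_{P\in\mathcal P_f}P\bigl(\tau_P\preceq U_n(X_1,\dots,X_n)\bigr)=0$.
   Context: Strings. $A^\star$ is the set of finite strings over $A$, including the empty string $\lambda$; $A^\infty$ is the set of left-infinite sequences over $A$. $w$ is a suffix of $s$ if $s=vw$ for some (finite or left-infinite) $v$; it is a proper suffix if moreover $|v|\ge1$. Trees. A tree $\tau$ is a set of finite strings and/or left-infinite sequences (its leaves) such that no $w\in\tau$ is a proper suffix of another $s\in\tau$. It is irreducible if no $w\in\tau$ can be replaced by a proper suffix of $w$ without violating the tree property. A node of $\tau$ is a finite string that is a suffix (proper or not) of some $s\in\tau$; $\bar\tau\subset A^\star$ is the set of nodes, and $\tau$ is identified with $\bar\tau$. $\mathcal T$ is the set of irreducible trees, partially ordered by $\tau\preceq\tau'$ iff $\bar\tau\subseteq\bar\tau'$, and $\tau\prec\tau'$ iff $\bar\tau\subsetneq\bar\tau'$.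 $\tau^\infty$ denotes the tree $A^\infty$ (all left-infinite sequences; its node set is $A^\star$). Measures and contexts. $\mathcal P$ is the set of shift-invariant ergodic probability measures on $A^{\mathbb Z}$ with the product $\sigma$-algebra; $(X_i)_{i\in\mathbb Z}$ is the coordinate process. For $s\in A^\star$, $P(s)$ is the probability that $|s|$ consecutive coordinates form $s$ ($P(\lambda)=1$), and if $P(s)>0$, $P(a|s)=P(X_0=a\mid X_{-|s|}^{-1}=s)$, with $P(a|\lambda)=P(X_0=a)$. A finite string $s$ is a context of $P$ if: (1) $P(s)>0$ or $s=\lambda$; (2) $P(a|v)=P(a|s)$ for all $a\in A$ and all $v\in A^\star$ with $P(v)>0$ having $s$ as a suffix; (3) no proper suffix of $s$ satisfies (2). An infinite context is a left-infinite sequence $x_{-\infty}^{-1}$ all of whose finite suffixes $x_{-n}^{-1}$, $n\ge1$, have positive probability but none of them is a context. The set of all contexts (finite and infinite) of $P$ is an irreducible tree, the context tree $\tau_P$. It is finite if it consists of finitely many finite strings. *)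

theory Defs
  imports "HOL-Probability.Probability" "HOL-Library.Sublist"
begin

section \<open>Strings and trees\<close>

text \<open>
  \<open>Fin [w\<^sub>1, \<dots>, w\<^sub>k]\<close> is a finite string, and \<open>LInf x\<close> is the left-infinite sequence
  \<open>\<dots> (x 2) (x 1) (x 0)\<close>: the index counts positions from the right end.
\<close>

datatype 'a lstring = Fin "'a list" | LInf "nat \<Rightarrow> 'a"

fun lconc :: "'a lstring \<Rightarrow> 'a list \<Rightarrow> 'a lstring" where
  "lconc (Fin v) w = Fin (v @ w)"
| "lconc (LInf x) w =
     LInf (\<lambda>i. if i < length w then rev w ! i else x (i - length w))"

definition lsuffix :: "'a list \<Rightarrow> 'a lstring \<Rightarrow> bool" where
  "lsuffix w s \<longleftrightarrow> (\<exists>v. s = lconc v w)"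

text \<open>Nothing can be prepended to a left-infinite sequence, so proper suffixes are finite strings.\<close>

definition proper_lsuffix :: "'a list \<Rightarrow> 'a lstring \<Rightarrow> bool" where
  "proper_lsuffix w s \<longleftrightarrow> (\<exists>v. v \<noteq> Fin [] \<and> s = lconc v w)"

lemma lsuffix_Fin [simp]: "lsuffix w (Fin s) \<longleftrightarrow> suffix w s"
proof
  assume "lsuffix w (Fin s)"
  then obtain v where "Fin s = lconc v w" by (auto simp: lsuffix_def)
  then show "suffix w s" by (cases v) (auto simp: suffix_def)
next
  assume "suffix w s"
  then obtain v where "s = v @ w" by (auto simp: suffix_def)
  then show "lsuffix w (Fin s)" unfolding lsuffix_def by (intro exI[of _ "Fin v"]) simp
qed

lemma proper_lsuffix_Fin [simp]: "proper_lsuffix w (Fin s) \<longleftrightarrow> strict_suffix w s"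
proof
  assume "proper_lsuffix w (Fin s)"
  then obtain v where "v \<noteq> Fin []" "Fin s = lconc v w" by (auto simp: proper_lsuffix_def)
  then show "strict_suffix w s" by (cases v) (auto simp: strict_suffix_def suffix_def)
next
  assume "strict_suffix w s"
  then obtain v where "s = v @ w" "v \<noteq> []" by (auto simp: strict_suffix_def suffix_def)
  then show "proper_lsuffix w (Fin s)"
    unfolding proper_lsuffix_def by (intro exI[of _ "Fin v"]) simp
qed

lemma lsuffix_LInf: "lsuffix w (LInf x) \<longleftrightarrow> w = rev (map x [0..<length w])"
proof
  assume "lsuffix w (LInf x)"
  then obtain v where v: "LInf x = lconc v w" by (auto simp: lsuffix_def)
  then have "\<forall>i < length w. x i = rev w ! i" by (cases v) auto
  then have "rev w = map x [0..<length w]" by (intro nth_equalityI) auto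
  then show "w = rev (map x [0..<length w])" by (metis rev_rev_ident)
next
  assume w: "w = rev (map x [0..<length w])"
  then have "rev w = map x [0..<length w]" by (metis rev_rev_ident)
  then have "\<forall>i < length w. rev w ! i = x i" by simp
  then have "LInf x = lconc (LInf (\<lambda>i. x (i + length w))) w" by (auto simp: fun_eq_iff)
  then show "lsuffix w (LInf x)" unfolding lsuffix_def by blast
qed

definition is_tree :: "'a lstring set \<Rightarrow> bool" where
  "is_tree \<tau> \<longleftrightarrow> (\<forall>w s. Fin w \<in> \<tau> \<longrightarrow> s \<in> \<tau> \<longrightarrow> \<not> proper_lsuffix w s)"

definition irreducible_trees :: "'a lstring set set" where
  "irreducible_trees =
     {\<tau>. is_tree \<tau> \<and>
         (\<forall>w\<in>\<tau>. \<forall>u. proper_lsuffix u w \<longrightarrow> \<not> is_tree (insert (Fin u) (\<tau> - {w})))}"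

definition nodes :: "'a lstring set \<Rightarrow> 'a list set" where
  "nodes \<tau> = {w. \<exists>s\<in>\<tau>. lsuffix w s}"

text \<open>
  Trees are compared through their node sets. Distinct sets of leaves may have the same nodes; such
  trees are identified, so the strict relation is strict inclusion of node sets.
\<close>

definition tree_le :: "'a lstring set \<Rightarrow> 'a lstring set \<Rightarrow> bool" (infix \<open>\<preceq>\<^sub>T\<close> 50) where
  "\<tau> \<preceq>\<^sub>T \<tau>' \<longleftrightarrow> nodes \<tau> \<subseteq> nodes \<tau>'"

definition tree_less :: "'a lstring set \<Rightarrow> 'a lstring set \<Rightarrow> bool" (infix \<open>\<prec>\<^sub>T\<close> 50) where
  "\<tau> \<prec>\<^sub>T \<tau>' \<longleftrightarrow> nodes \<tau> \<subset> nodes \<tau>'"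

definition full_tree :: "'a lstring set" where
  "full_tree = range LInf"

lemma nodes_full_tree: "nodes full_tree = UNIV"
proof -
  have "lsuffix w (lconc (LInf (\<lambda>_. undefined)) w)" for w :: "'a list"
    unfolding lsuffix_def by blast
  then show ?thesis unfolding nodes_def full_tree_def by fastforce
qed

definition finite_tree :: "'a lstring set \<Rightarrow> bool" where
  "finite_tree \<tau> \<longleftrightarrow> finite \<tau> \<and> \<tau> \<subseteq> range Fin"


section \<open>Stationary ergodic measures\<close>

definition path_space :: "(int \<Rightarrow> 'a) measure" where
  "path_space = (\<Pi>\<^sub>M i\<in>UNIV. count_space UNIV)"

definition path_shift :: "(int \<Rightarrow> 'a) \<Rightarrow> int \<Rightarrow> 'a" where
  "path_shift \<omega> = (\<lambda>i. \<omega> (i + 1))"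

definition ergodic_measures :: "(int \<Rightarrow> 'a) measure set" where
  "ergodic_measures =
     {P. prob_space P \<and> sets P = sets path_space \<and> distr P path_space path_shift = P \<and>
         (\<forall>E\<in>sets P. path_shift -` E = E \<longrightarrow> measure P E = 0 \<or> measure P E = 1)}"


section \<open>Contexts\<close>

text \<open>The \<open>length s\<close> coordinates ending at time \<open>-1\<close> form the string \<open>s\<close>.\<close>

definition past_is :: "'a list \<Rightarrow> (int \<Rightarrow> 'a) \<Rightarrow> bool" where
  "past_is s \<omega> \<longleftrightarrow> map \<omega> [- int (length s)..-1] = s"

text \<open>
  By stationarity the block of coordinates at which a string is observed is immaterial.
\<close>

definition string_prob :: "(int \<Rightarrow> 'a) measure \<Rightarrow> 'a list \<Rightarrow> real" where
  "string_prob P s = \<P>(\<omega> in P. past_is s \<omega>)"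

definition trans_prob :: "(int \<Rightarrow> 'a) measure \<Rightarrow> 'a \<Rightarrow> 'a list \<Rightarrow> real" where
  "trans_prob P a s = \<P>(\<omega> in P. \<omega> 0 = a \<bar> past_is s \<omega>)"

definition memory_suffices :: "(int \<Rightarrow> 'a) measure \<Rightarrow> 'a list \<Rightarrow> bool" where
  "memory_suffices P s \<longleftrightarrow>
     (\<forall>a v. string_prob P v > 0 \<longrightarrow> suffix s v \<longrightarrow> trans_prob P a v = trans_prob P a s)"

definition finite_context :: "(int \<Rightarrow> 'a) measure \<Rightarrow> 'a list \<Rightarrow> bool" where
  "finite_context P s \<longleftrightarrow>
     (string_prob P s > 0 \<or> s = []) \<and> memory_suffices P s \<and>
     (\<forall>u. strict_suffix u s \<longrightarrow> \<not> memory_suffices P u)"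

text \<open>
  The finite suffixes considered here include the empty one. If it were left out, then for an
  i.i.d. process the empty string and also every left-infinite sequence with positive-probability
  suffixes would be contexts, and the contexts would not form a tree.
\<close>

definition infinite_context :: "(int \<Rightarrow> 'a) measure \<Rightarrow> (nat \<Rightarrow> 'a) \<Rightarrow> bool" where
  "infinite_context P x \<longleftrightarrow>
     (\<forall>w. lsuffix w (LInf x) \<longrightarrow> string_prob P w > 0 \<and> \<not> finite_context P w)"

definition context_tree :: "(int \<Rightarrow> 'a) measure \<Rightarrow> 'a lstring set" where
  "context_tree P = {Fin s | s. finite_context P s} \<union> {LInf x | x. infinite_context P x}"

definition finite_memory_measures :: "(int \<Rightarrow> 'a) measure set" where
  "finite_memory_measures = {P \<in> ergodic_measures. finite_tree (context_tree P)}"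

end

theory Submission
  imports Defs
begin

text \<open>
  The sample has bounded length, so it cannot reveal dependence on the remote past. Fix a measure \<open>P\<close>
  under which the estimated tree is different from the full tree with probability close to \<open>1\<close>. For
  each of the finitely many samples with this property choose a string that is not a node of the
  estimated tree, and let \<open>K\<close> be at least the sample size and the lengths of these strings. It suffices
  to find an ergodic measure \<open>Q\<close> with finite context tree that is close to \<open>P\<close> on words of length
  \<open>n\<close> and whose context tree consists of all words of length \<open>K\<close>. The nodes of this tree are all words
  of length at most \<open>K\<close>, including the chosen strings, so under \<open>Q\<close> the event that the estimated tree
  contains the context tree has small probability.

  The measure \<open>Q\<close> is a stationary Markov chain of order \<open>K\<close>. It starts from the law of \<open>P\<close> on words of
  length \<open>K + 1\<close>, mixed with a little of the uniform law to make every word possible. A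
  perturbation that does not change the law on words of length \<open>K\<close> then makes the oldest letter in the
  memory relevant, whatever the other letters are (\<open>ex_branching_markov_law\<close>). Consequently a word
  determines the transition probabilities exactly if it has length at least \<open>K\<close>
  (\<open>memory_suffices_iff\<close>), and the contexts are the words of length \<open>K\<close>.

  The chain is constructed as a measure on two-sided sequences from its probabilities of
  words by Kolmogorov's extension theorem (\<open>measure_process_window\<close>). It is ergodic because all its
  transition probabilities are positive: after a gap of \<open>K\<close> letters the past has been forgotten up to
  a constant factor (\<open>chain_gap\<close>), and such a one-sided bound is enough to rule out nontrivial
  invariant events (\<open>ergodic_if_weakly_mixing_cylinders\<close>).
\<close>

section \<open>Words and consistent laws on words\<close>

abbreviation words :: "nat \<Rightarrow> 'a list set" where
  "words k \<equiv> {w. length w = k}"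

lemma finite_words [simp]: "finite (words k :: 'a::finite list set)"
  using finite_lists_length_eq[of "UNIV :: 'a set" k] by simp

lemma sum_words_append:
  "(\<Sum>w\<in>words (j + k). f w) = (\<Sum>u\<in>words j. \<Sum>v\<in>words k. f (u @ v :: 'a::finite list))"
proof -
  have "(\<Sum>u\<in>words j. \<Sum>v\<in>words k. f (u @ v)) = (\<Sum>(u, v)\<in>words j \<times> words k. f (u @ v))"
    by (rule sum.cartesian_product)
  also have "\<dots> = (\<Sum>w\<in>words (j + k). f w)"
    by (rule sum.reindex_bij_witness[of _ "\<lambda>w. (take j w, drop j w)" "\<lambda>(u, v). u @ v"]) auto
  finally show ?thesis by simp
qed

lemma sum_words_1: "(\<Sum>w\<in>words (Suc 0). f w) = (\<Sum>a\<in>UNIV. f [a :: 'a::finite])"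
  by (rule sum.reindex_bij_witness[of _ "\<lambda>a. [a]" hd]) (auto simp: length_Suc_conv)

lemma sum_words_Cons: "(\<Sum>w\<in>words (Suc k). f w) = (\<Sum>a\<in>UNIV. \<Sum>w\<in>words k. f (a # w :: 'a::finite list))"
  using sum_words_append[of f "Suc 0" k] by (simp add: sum_words_1)

lemma sum_words_snoc: "(\<Sum>w\<in>words (Suc k). f w) = (\<Sum>w\<in>words k. \<Sum>a\<in>UNIV. f (w @ [a] :: 'a::finite list))"
  using sum_words_append[of f k "Suc 0"] by (simp add: sum_words_1)

text \<open>
  The candidates for \<open>string_prob\<close> of a stationary measure: consistency on the right makes \<open>q\<close> a
  family of finite-dimensional distributions, consistency on the left makes it translation invariant.
\<close>

locale word_law =
  fixes q :: "'a::finite list \<Rightarrow> real"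
  assumes nonneg: "0 \<le> q s"
    and q_Nil [simp]: "q [] = 1"
    and sum_Cons: "(\<Sum>a\<in>UNIV. q (a # s)) = q s"
    and sum_snoc: "(\<Sum>a\<in>UNIV. q (s @ [a])) = q s"
begin

lemma sum_prepend: "(\<Sum>v\<in>words k. q (v @ s)) = q s"
proof (induction k)
  case (Suc k)
  have "(\<Sum>v\<in>words (Suc k). q (v @ s)) = (\<Sum>v\<in>words k. \<Sum>a\<in>UNIV. q (a # v @ s))"
    by (subst sum.swap) (simp add: sum_words_Cons)
  with Suc show ?case by (simp add: sum_Cons)
qed simp

lemma sum_extend: "(\<Sum>v\<in>words k. q (s @ v)) = q s"
proof (induction k)
  case (Suc k)
  have "(\<Sum>v\<in>words (Suc k). q (s @ v)) = (\<Sum>v\<in>words k. \<Sum>a\<in>UNIV. q ((s @ v) @ [a]))"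
    by (simp add: sum_words_snoc)
  with Suc show ?case by (simp only: sum_snoc)
qed simp

lemma sum_words_eq_1: "(\<Sum>v\<in>words k. q v) = 1"
  using sum_extend[of "[]" k] by simp

lemma le_1: "q s \<le> 1"
  using member_le_sum[of s "words (length s)" q] by (simp add: nonneg sum_words_eq_1)

definition law :: "nat \<Rightarrow> 'a list pmf" where
  "law k = embed_pmf (\<lambda>s. if length s = k then q s else 0)"

lemma pmf_law: "pmf (law k) s = (if length s = k then q s else 0)"
  unfolding law_def
proof (rule pmf_embed_pmf)
  have "(\<integral>\<^sup>+ s. ennreal (if length s = k then q s else 0) \<partial>count_space UNIV)
      = (\<Sum>s\<in>words k. ennreal (if length s = k then q s else 0))"
    by (rule nn_integral_count_space') auto
  also have "\<dots> = ennreal (\<Sum>s\<in>words k. q s)"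
    by (subst sum_ennreal[symmetric]) (auto simp: nonneg)
  finally show "(\<integral>\<^sup>+ s. ennreal (if length s = k then q s else 0) \<partial>count_space UNIV) = 1"
    by (simp add: sum_words_eq_1)
qed (simp add: nonneg)

lemma set_law: "set_pmf (law k) \<subseteq> words k"
  by (auto simp: set_pmf_iff pmf_law split: if_splits)

lemma measure_law: "measure (law k) S = (\<Sum>s\<in>words k. if s \<in> S then q s else 0)"
proof -
  have "measure (law k) S = measure (law k) (S \<inter> words k)"
    by (rule measure_pmf.finite_measure_eq_AE) (use set_law in \<open>auto simp: AE_measure_pmf_iff\<close>)
  also have "\<dots> = (\<Sum>s\<in>S \<inter> words k. q s)"
    by (subst measure_measure_pmf_finite) (auto simp: pmf_law intro!: sum.cong)
  also have "\<dots> = (\<Sum>s\<in>words k. if s \<in> S then q s else 0)"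
    by (subst Int_commute) (simp add: sum.inter_restrict)
  finally show ?thesis .
qed

lemma law_infix: "map_pmf (\<lambda>w. take k (drop j w)) (law (j + k + l)) = law k"
proof (rule pmf_eqI)
  fix s
  have "pmf (map_pmf (\<lambda>w. take k (drop j w)) (law (j + k + l))) s
      = (\<Sum>u\<in>words j. \<Sum>x\<in>words k. \<Sum>v\<in>words l. if x = s then q (u @ x @ v) else 0)"
    by (simp add: pmf_map measure_law sum_words_append append_assoc cong: if_cong)
  also have "\<dots> = (\<Sum>u\<in>words j. \<Sum>x\<in>words k. if x = s then q (u @ x) else 0)"
    using sum_extend[of "_ @ _" l] by (intro sum.cong refl) auto
  also have "\<dots> = (\<Sum>u\<in>words j. if length s = k then q (u @ s) else 0)"
    by (simp add: sum.delta)
  also have "\<dots> = pmf (law k) s"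
    by (simp add: sum_prepend pmf_law)
  finally show "pmf (map_pmf (\<lambda>w. take k (drop j w)) (law (j + k + l))) s = pmf (law k) s" .
qed

end

section \<open>The process with a given law on words\<close>

definition window :: "int \<Rightarrow> nat \<Rightarrow> (int \<Rightarrow> 'a) \<Rightarrow> 'a list" where
  "window m k \<omega> = map (\<lambda>i. \<omega> (m + int i)) [0..<k]"

lemma length_window [simp]: "length (window m k \<omega>) = k"
  by (simp add: window_def)

lemma measurable_map_upt:
  fixes f :: "'b \<Rightarrow> nat \<Rightarrow> 'a::countable"
  assumes "\<And>i. i < k \<Longrightarrow> (\<lambda>x. f x i) \<in> measurable M (count_space UNIV)"
  shows "(\<lambda>x. map (f x) [0..<k]) \<in> measurable M (count_space UNIV)"
  using assms
proof (induction k)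
  case (Suc k)
  have 1: "(\<lambda>x. map (f x) [0..<k]) \<in> measurable M (count_space UNIV)" using Suc by simp
  have 2: "(\<lambda>x. f x k) \<in> measurable M (count_space UNIV)" using Suc by simp
  have "(\<lambda>x. (\<lambda>w x. w @ [f x k]) (map (f x) [0..<k]) x) \<in> measurable M (count_space UNIV)"
    by (rule measurable_compose_countable[OF _ 1], rule measurable_compose[OF 2]) simp
  then show ?case by simp
qed simp

lemma measurable_coord_path_space: "(\<lambda>\<omega>. \<omega> i) \<in> measurable path_space (count_space UNIV)"
  unfolding path_space_def by (rule measurable_component_singleton) simp

lemma space_path_space [simp]: "space path_space = UNIV"
  by (simp add: path_space_def space_PiM)

lemma measurable_window [measurable]:
  "window m k \<in> measurable (path_space :: (int \<Rightarrow> 'a::finite) measure) (count_space UNIV)"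
  unfolding window_def[abs_def] by (intro measurable_map_upt measurable_coord_path_space)

context word_law
begin

text \<open>
  Kolmogorov's extension theorem needs one distribution for every finite set \<open>J\<close> of times. It is read
  off from a word with law \<open>q\<close> that is placed on an interval covering \<open>J\<close>; here the interval starts at
  \<open>m\<close> and has length \<open>k\<close>. The alphabet carries the discrete topology, because the extension theorem
  is about Polish spaces.
\<close>

definition marginal_from :: "int \<Rightarrow> nat \<Rightarrow> int set \<Rightarrow> (int \<Rightarrow> 'a discrete) measure" where
  "marginal_from m k J =
     distr (law k) (\<Pi>\<^sub>M i\<in>J. borel) (\<lambda>w. \<lambda>i\<in>J. discrete (w ! nat (i - m)))"

text \<open>
  The covering interval is immaterial because an infix of a word with law \<open>q\<close> again has law \<open>q\<close>:
  this is where both consistency conditions enter.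
\<close>

lemma marginal_from_widen:
  assumes "J \<subseteq> {m..<m + int k}" "m' \<le> m" "m + int k \<le> m' + int k'"
  shows "marginal_from m' k' J = marginal_from m k J"
proof -
  define j where "j = nat (m - m')"
  define l where "l = k' - j - k"
  have k': "k' = j + k + l" and m: "m = m' + int j" using assms by (auto simp: j_def l_def)
  have "marginal_from m k J = distr (distr (law k') (count_space UNIV) (\<lambda>w. take k (drop j w)))
          (\<Pi>\<^sub>M i\<in>J. borel) (\<lambda>w. \<lambda>i\<in>J. discrete (w ! nat (i - m)))"
    unfolding marginal_from_def by (subst law_infix[of k j l, symmetric]) (simp add: k' map_pmf_rep_eq)
  also have "\<dots> = distr (law k') (\<Pi>\<^sub>M i\<in>J. borel)
          (\<lambda>w. \<lambda>i\<in>J. discrete (take k (drop j w) ! nat (i - m)))"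
    by (subst distr_distr) (auto simp: o_def space_PiM)
  also have "\<dots> = marginal_from m' k' J"
    unfolding marginal_from_def
  proof (rule distr_cong_AE)
    show "AE w in law k'. (\<lambda>i\<in>J. discrete (take k (drop j w) ! nat (i - m)))
                        = (\<lambda>i\<in>J. discrete (w ! nat (i - m')))"
      unfolding AE_measure_pmf_iff
    proof (intro ballI restrict_ext)
      fix w i assume "w \<in> set_pmf (law k')" "i \<in> J"
      moreover have "nat (i - m') = j + nat (i - m)" if "i \<ge> m"
        using that m by simp
      ultimately show "discrete (take k (drop j w) ! nat (i - m)) = discrete (w ! nat (i - m'))"
        using assms(1) set_law[of k'] k' by (fastforce simp: nth_drop)
    qed
  qed (auto simp: space_PiM)
  finally show ?thesis by simp
qed

definition marginal :: "int set \<Rightarrow> (int \<Rightarrow> 'a discrete) measure" where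
  "marginal J = (let N = Max (insert 0 (abs ` J)) in marginal_from (- N) (nat (2 * N + 1)) J)"

lemma marginal_eq:
  assumes "J \<subseteq> {m..<m + int k}"
  shows "marginal J = marginal_from m k J"
proof -
  have fin: "finite J" using assms finite_subset by blast
  define N where "N = Max (insert 0 (abs ` J))"
  have N: "0 \<le> N" "\<bar>i\<bar> \<le> N" if "i \<in> J" for i
    unfolding N_def using fin that by (auto intro!: Max_ge)
  have "0 \<le> N" unfolding N_def using fin by (auto intro!: Max_ge)
  define L where "L = max N (\<bar>m\<bar> + int k)"
  have "marginal_from (- L) (nat (2 * L + 1)) J = marginal_from (- N) (nat (2 * N + 1)) J"
    using N \<open>0 \<le> N\<close> by (intro marginal_from_widen) (auto simp: L_def abs_le_iff dest!: N(2))
  moreover have "marginal_from (- L) (nat (2 * L + 1)) J = marginal_from m k J"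
    using assms by (intro marginal_from_widen) (auto simp: L_def)
  ultimately show ?thesis by (simp add: marginal_def N_def)
qed

lemma finite_int_set_window:
  assumes "finite (J :: int set)" obtains m k where "J \<subseteq> {m..<m + int k}"
proof -
  obtain a b where "J \<subseteq> {a..b}"
    using assms by (metis bdd_above_finite bdd_below_finite bdd_above_def bdd_below_def
        atLeastAtMost_iff subsetI)
  then have "J \<subseteq> {a..<a + int (nat (b - a + 1))}" by auto
  then show thesis by (rule that)
qed

lemma polish_projective_marginal: "polish_projective UNIV marginal"
proof (intro polish_projective.intro projective_family.intro)
  fix J H :: "int set" assume "J \<subseteq> H" "finite H"
  then obtain m k where mk: "H \<subseteq> {m..<m + int k}" by (meson finite_int_set_window)
  have "distr (marginal H) (\<Pi>\<^sub>M i\<in>J. borel) (\<lambda>f. restrict f J) = marginal_from m k J"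
    unfolding marginal_eq[OF mk] marginal_from_def using \<open>J \<subseteq> H\<close>
    by (subst distr_distr)
      (auto simp: o_def space_PiM Int_absorb1 restrict_restrict intro!: distr_cong measurable_restrict_subset)
  then show "marginal J = distr (marginal H) (\<Pi>\<^sub>M i\<in>J. borel) (\<lambda>f. restrict f J)"
    using \<open>J \<subseteq> H\<close> mk by (subst marginal_eq[of J m k]) auto
next
  fix J :: "int set" assume "finite J"
  then obtain m k where mk: "J \<subseteq> {m..<m + int k}" by (meson finite_int_set_window)
  show "prob_space (marginal J)"
    unfolding marginal_eq[OF mk] marginal_from_def
    by (rule measure_pmf.prob_space_distr) (auto simp: space_PiM)
qed

definition process :: "(int \<Rightarrow> 'a) measure" where
  "process = distr (projective_family.lim UNIV marginal (\<lambda>_. borel)) path_space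
               (\<lambda>\<omega> i. of_discrete (\<omega> i))"

lemma measurable_of_discrete: "of_discrete \<in> measurable borel (count_space (UNIV :: 'a set))"
  by (rule measurableI) (auto intro: borel_open open_discrete)

lemma measurable_coord_of_discrete:
  "i \<in> J \<Longrightarrow> (\<lambda>x. of_discrete (x i)) \<in> measurable (\<Pi>\<^sub>M i\<in>J. borel) (count_space (UNIV :: 'a set))"
  by (rule measurable_compose[of "\<lambda>x. x i" _ borel, OF _ measurable_of_discrete])
     (rule measurable_component_singleton)

lemma measurable_of_discrete_path:
  "(\<lambda>\<omega> i. of_discrete (\<omega> i)) \<in> measurable (\<Pi>\<^sub>M i\<in>UNIV. borel) (path_space :: (int \<Rightarrow> 'a) measure)"
  unfolding path_space_def
  by (rule measurable_PiM_single')
     (auto intro!: measurable_coord_of_discrete)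

lemma sets_process: "sets process = sets path_space"
  by (simp add: process_def)

lemma prob_space_process: "prob_space process"
proof -
  interpret polish_projective UNIV marginal by (rule polish_projective_marginal)
  show ?thesis
    unfolding process_def
    by (rule P.prob_space_distr) (simp add: measurable_of_discrete_path cong: measurable_cong_sets)
qed

lemma measure_process_window:
  "measure process {\<omega>. window m k \<omega> \<in> S} = measure (law k) S"
proof -
  interpret polish_projective UNIV marginal by (rule polish_projective_marginal)
  define J where "J = {m..<m + int k}"
  define W :: "(int \<Rightarrow> 'a discrete) \<Rightarrow> 'a list" where "W x = map (\<lambda>i. of_discrete (x (m + int i))) [0..<k]" for x
  define X where "X = {x \<in> space (\<Pi>\<^sub>M i\<in>J. borel). W x \<in> S}"
  have "W \<in> measurable (\<Pi>\<^sub>M i\<in>J. borel) (count_space UNIV)"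
    unfolding W_def[abs_def]
    by (intro measurable_map_upt measurable_coord_of_discrete)
       (auto simp: J_def)
  then have X: "X \<in> sets (\<Pi>\<^sub>M i\<in>J. borel)"
    unfolding X_def by (rule measurable_sets_Collect) simp
  have W_restrict: "W (restrict x J) = window m k (\<lambda>i. of_discrete (x i))" for x
    by (auto simp: W_def window_def J_def)
  have "{\<omega>. window m k \<omega> \<in> S} \<in> sets path_space"
    using measurable_sets[OF measurable_window, of S m k] by (simp add: vimage_def)
  then have "measure process {\<omega>. window m k \<omega> \<in> S} = measure lim (emb UNIV J X)"
    unfolding process_def
    by (subst measure_distr)
       (auto simp: measurable_of_discrete_path X_def prod_emb_def space_PiM W_restrict[symmetric] PiE_def
             cong: measurable_cong_sets intro!: arg_cong[where f="measure lim"])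
  also have "\<dots> = measure (marginal J) X"
    by (rule measure_lim_emb[OF _ _ X]) (auto simp: J_def)
  also have "\<dots> = measure (law k) {w. W (\<lambda>i\<in>J. discrete (w ! nat (i - m))) \<in> S}"
    unfolding marginal_eq[of J m k, OF eq_refl[OF J_def]] marginal_from_def
    by (subst measure_distr[OF _ X]) (auto simp: space_PiM X_def)
  also have "\<dots> = measure (law k) S"
  proof (rule measure_pmf.finite_measure_eq_AE)
    have "W (\<lambda>i\<in>J. discrete (w ! nat (i - m))) = w" if "length w = k" for w
      using that by (auto simp: W_def J_def discrete_inverse intro!: nth_equalityI)
    then show "AE w in law k. (w \<in> {w. W (\<lambda>i\<in>J. discrete (w ! nat (i - m))) \<in> S}) = (w \<in> S)"
      unfolding AE_measure_pmf_iff using set_law[of k] by auto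
  qed auto
  finally show ?thesis .
qed

end


section \<open>Cylinders, stationarity and ergodicity\<close>

definition cylinder :: "nat \<Rightarrow> 'a list set \<Rightarrow> (int \<Rightarrow> 'a) set" where
  "cylinder N S = {\<omega>. window (- int N) (2 * N + 1) \<omega> \<in> S}"

lemma window_infix: "take k (drop j (window m (j + k + l) \<omega>)) = window (m + int j) k \<omega>"
  by (rule nth_equalityI) (auto simp: window_def algebra_simps)

lemma cylinder_widen:
  assumes "N \<le> N'"
  shows "\<exists>S'. cylinder N S = cylinder N' S'"
proof -
  have "2 * N' + 1 = (N' - N) + (2 * N + 1) + (N' - N)" using assms by simp
  then have "window (- int N) (2 * N + 1) \<omega> = take (2 * N + 1) (drop (N' - N) (window (- int N') (2 * N' + 1) \<omega>))"
    for \<omega> :: "int \<Rightarrow> 'a"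
    using window_infix[of "2 * N + 1" "N' - N" "- int N'" "N' - N" \<omega>] assms by (simp add: of_nat_diff mult_2)
  then have "cylinder N S = cylinder N' {w. take (2 * N + 1) (drop (N' - N) w) \<in> S}"
    by (simp add: cylinder_def)
  then show ?thesis by blast
qed

lemma cylinder_Compl: "- cylinder N S = cylinder N (- S)"
  by (auto simp: cylinder_def)

lemma cylinder_pair:
  obtains N S T where "cylinder N1 S1 = cylinder N S" "cylinder N2 S2 = cylinder N T"
  using cylinder_widen[of N1 "max N1 N2" S1] cylinder_widen[of N2 "max N1 N2" S2] by auto

lemma cylinder_Un: "\<exists>N S. cylinder N1 S1 \<union> cylinder N2 S2 = cylinder N S"
proof -
  obtain N S T where *: "cylinder N1 S1 = cylinder N S" "cylinder N2 S2 = cylinder N T"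
    by (rule cylinder_pair)
  have "cylinder N S \<union> cylinder N T = cylinder N (S \<union> T)" by (auto simp: cylinder_def)
  with * show ?thesis by metis
qed

lemma Int_stable_cylinders: "Int_stable (range (case_prod cylinder))"
proof (rule Int_stableI)
  fix a b :: "(int \<Rightarrow> 'a) set" assume "a \<in> range (case_prod cylinder)" "b \<in> range (case_prod cylinder)"
  then obtain N1 S1 N2 S2 where ab: "a = cylinder N1 S1" "b = cylinder N2 S2" by auto
  obtain N S T where *: "cylinder N1 S1 = cylinder N S" "cylinder N2 S2 = cylinder N T"
    by (rule cylinder_pair)
  have "cylinder N S \<inter> cylinder N T = cylinder N (S \<inter> T)" by (auto simp: cylinder_def)
  with * ab have "a \<inter> b = case_prod cylinder (N, S \<inter> T)" by simp
  then show "a \<inter> b \<in> range (case_prod cylinder)" by blast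
qed

lemma sets_window [measurable]:
  "{\<omega>. window m k \<omega> \<in> S} \<in> sets (path_space :: (int \<Rightarrow> 'a::finite) measure)"
  using measurable_sets[OF measurable_window, of S m k] by (simp add: vimage_def)

lemma sets_cylinder [measurable]:
  "cylinder N S \<in> sets (path_space :: (int \<Rightarrow> 'a::finite) measure)"
  unfolding cylinder_def by (rule sets_window)

text \<open>
  Every coordinate can be read from a large enough symmetric window, so cylinders generate.
\<close>

lemma sets_path_space_eq:
  "sets (path_space :: (int \<Rightarrow> 'a::finite) measure) = sigma_sets UNIV (range (case_prod cylinder))"
proof (rule antisym)
  let ?G = "range (case_prod cylinder) :: (int \<Rightarrow> 'a) set set"
  have coord: "{\<omega>. \<omega> i \<in> A} \<in> ?G" for i :: int and A :: "'a set"
  proof -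
    let ?N = "nat \<bar>i\<bar>"
    have "window (- int ?N) (2 * ?N + 1) \<omega> ! nat (i + int ?N) = \<omega> i" for \<omega> :: "int \<Rightarrow> 'a"
      unfolding window_def by (subst nth_map) (auto simp: nat_less_iff simp del: upt_Suc)
    then have "{\<omega>. \<omega> i \<in> A} = case_prod cylinder (?N, {w. w ! nat (i + int ?N) \<in> A})"
      by (simp add: cylinder_def)
    then show ?thesis by blast
  qed
  show "sets (path_space :: (int \<Rightarrow> 'a) measure) \<subseteq> sigma_sets UNIV ?G"
    unfolding path_space_def sets_PiM_single
    using coord by (simp, intro sigma_sets_mono') auto
  show "sigma_sets UNIV ?G \<subseteq> sets (path_space :: (int \<Rightarrow> 'a) measure)"
    using sets.sigma_sets_subset[of ?G path_space] by (simp add: image_subset_iff)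
qed

lemma path_shift_power: "(path_shift ^^ m) \<omega> = (\<lambda>i. \<omega> (i + int m))"
  by (induction m arbitrary: \<omega>) (auto simp: path_shift_def funpow_swap1 algebra_simps)

lemma window_path_shift: "window a k (path_shift \<omega>) = window (a + 1) k \<omega>"
  by (auto simp: window_def path_shift_def algebra_simps)

lemma window_path_shift_power: "window a k ((path_shift ^^ m) \<omega>) = window (a + int m) k \<omega>"
  by (auto simp: window_def path_shift_power algebra_simps)

lemma measurable_path_shift [measurable]:
  "path_shift \<in> measurable path_space (path_space :: (int \<Rightarrow> 'a::finite) measure)"
  unfolding path_shift_def[abs_def] path_space_def
  by (rule measurable_PiM_single') (auto simp: space_PiM)

lemma map_upto_window: "map \<omega> [a..b] = window a (nat (b - a + 1)) \<omega>"
  by (rule nth_equalityI) (auto simp: window_def nth_upto)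

lemma past_is_window: "past_is s \<omega> \<longleftrightarrow> window (- int (length s)) (length s) \<omega> = s"
  by (simp add: past_is_def map_upto_window)

locale path_measure = prob_space P for P :: "(int \<Rightarrow> 'a::finite) measure" +
  assumes sets_P [measurable_cong]: "sets P = sets path_space"
begin

lemma space_P [simp]: "space P = UNIV"
  using sets_eq_imp_space_eq[OF sets_P] by simp

text \<open>
  An invariant event need not be determined by finitely many coordinates. Events become accessible to
  estimates on words because every event is a limit in measure of cylinders: the events with this
  property form a \<open>\<sigma>\<close>-algebra, and it contains the cylinders.
\<close>

definition approximable :: "(int \<Rightarrow> 'a) set \<Rightarrow> bool" where
  "approximable E \<longleftrightarrow> (\<forall>e>0. \<exists>N S. prob (sym_diff E (cylinder N S)) < e)"

lemma approximable_cylinder: "approximable (cylinder N S)"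
  unfolding approximable_def by (metis Diff_cancel Un_absorb measure_empty)

lemma approximable_Un:
  assumes "approximable E" "approximable F" and [measurable]: "E \<in> events" "F \<in> events"
  shows "approximable (E \<union> F)"
  unfolding approximable_def
proof (intro allI impI)
  fix e :: real assume "e > 0"
  then obtain N1 S1 N2 S2 where 1: "prob (sym_diff E (cylinder N1 S1)) < e / 2"
      and 2: "prob (sym_diff F (cylinder N2 S2)) < e / 2"
    using assms(1,2) unfolding approximable_def by (metis half_gt_zero)
  obtain N S where NS: "cylinder N1 S1 \<union> cylinder N2 S2 = cylinder N S" using cylinder_Un by blast
  have "prob (sym_diff (E \<union> F) (cylinder N S))
      \<le> prob (sym_diff E (cylinder N1 S1) \<union> sym_diff F (cylinder N2 S2))"
    unfolding NS[symmetric] by (rule finite_measure_mono) (blast, measurable)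
  also have "\<dots> \<le> prob (sym_diff E (cylinder N1 S1)) + prob (sym_diff F (cylinder N2 S2))"
    by (rule measure_Un_le) measurable
  finally show "\<exists>N S. prob (sym_diff (E \<union> F) (cylinder N S)) < e"
    using 1 2 by (intro exI[of _ N] exI[of _ S]) linarith
qed

lemma approximable_events:
  assumes "E \<in> events" shows "approximable E"
proof -
  have "E \<in> sigma_sets UNIV (range (case_prod cylinder))"
    using assms sets_P sets_path_space_eq by blast
  then show ?thesis
  proof induction
    case (Basic a)
    then show ?case using approximable_cylinder by auto
  next
    case Empty
    have "cylinder 0 {} = ({} :: (int \<Rightarrow> 'a) set)" by (simp add: cylinder_def)
    then show ?case using approximable_cylinder by metis
  next
    case (Compl a)
    have "sym_diff (- a) (cylinder N (- S)) = sym_diff a (cylinder N S)" for N S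
      unfolding cylinder_Compl[symmetric] by blast
    with Compl show ?case unfolding approximable_def Compl_eq_Diff_UNIV[symmetric] by metis
  next
    case (Union A)
    have A [measurable]: "A i \<in> events" for i
      using Union.hyps sets_P sets_path_space_eq by blast
    have fin: "approximable (\<Union>i<n. A i)" for n
    proof (induction n)
      case 0
      have "cylinder 0 {} = ({} :: (int \<Rightarrow> 'a) set)" by (simp add: cylinder_def)
      then show ?case using approximable_cylinder by (metis UN_empty lessThan_0)
    next
      case (Suc n)
      then show ?case using Union.IH by (auto simp: lessThan_Suc intro!: approximable_Un)
    qed
    show ?case
      unfolding approximable_def
    proof (intro allI impI)
      fix e :: real assume "e > 0"
      have "(\<lambda>n. prob (\<Union>i<n. A i)) \<longlonglongrightarrow> prob (\<Union>n. \<Union>i<n. A i)"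
        by (rule finite_Lim_measure_incseq) (auto intro!: incseq_SucI simp: lessThan_Suc)
      moreover have "(\<Union>n. \<Union>i<n. A i) = (\<Union>i. A i)" by auto
      ultimately have "(\<lambda>n. prob (\<Union>i<n. A i)) \<longlonglongrightarrow> prob (\<Union>i. A i)" by simp
      from tendstoD[OF this, of "e / 2"] \<open>e > 0\<close>
      obtain n where n: "\<bar>prob (\<Union>i<n. A i) - prob (\<Union>i. A i)\<bar> < e / 2"
        by (auto simp: eventually_sequentially dist_real_def)
      obtain N S where NS: "prob (sym_diff (\<Union>i<n. A i) (cylinder N S)) < e / 2"
        using fin[of n] \<open>e > 0\<close> unfolding approximable_def by (metis half_gt_zero)
      have "prob (sym_diff (\<Union>i. A i) (cylinder N S))
          \<le> prob (((\<Union>i. A i) - (\<Union>i<n. A i)) \<union> sym_diff (\<Union>i<n. A i) (cylinder N S))"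
        by (rule finite_measure_mono) (blast, measurable)
      also have "\<dots> \<le> prob ((\<Union>i. A i) - (\<Union>i<n. A i)) + prob (sym_diff (\<Union>i<n. A i) (cylinder N S))"
        by (rule measure_Un_le) measurable
      also have "prob ((\<Union>i. A i) - (\<Union>i<n. A i)) = prob (\<Union>i. A i) - prob (\<Union>i<n. A i)"
        by (rule finite_measure_Diff) auto
      finally show "\<exists>N S. prob (sym_diff (\<Union>i. A i) (cylinder N S)) < e"
        using n NS by (intro exI[of _ N] exI[of _ S]) linarith
    qed
  qed
qed

end

locale stationary_measure = path_measure +
  assumes shift_invariant: "distr P path_space path_shift = P"
begin

lemma prob_shift_vimage:
  assumes "E \<in> events" shows "prob (path_shift -` E) = prob E"
proof -
  have "prob E = measure (distr P path_space path_shift) E" by (simp add: shift_invariant)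
  also have "\<dots> = prob (path_shift -` E)"
    using assms sets_P by (subst measure_distr) auto
  finally show ?thesis by simp
qed

lemma shift_power_events:
  assumes "E \<in> events" shows "(path_shift ^^ m) -` E \<in> events"
proof (induction m)
  case (Suc m)
  have "path_shift -` ((path_shift ^^ m) -` E) \<in> events"
    using measurable_sets[OF measurable_path_shift, of "(path_shift ^^ m) -` E"] Suc sets_P by auto
  then show ?case by (simp add: vimage_comp funpow_swap1 o_def)
qed (use assms in simp)

lemma prob_shift_power_vimage:
  assumes "E \<in> events" shows "prob ((path_shift ^^ m) -` E) = prob E"
proof (induction m)
  case (Suc m)
  have "prob (path_shift -` ((path_shift ^^ m) -` E)) = prob E"
    using prob_shift_vimage[OF shift_power_events[OF assms]] Suc by simp
  then show ?case by (simp add: vimage_comp funpow_swap1 o_def)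
qed simp

lemma prob_window_invariant:
  "prob {\<omega>. window m k \<omega> \<in> S} = prob {\<omega>. window m' k \<omega> \<in> S}"
proof -
  have "prob {\<omega>. window (m + int j) k \<omega> \<in> S} = prob {\<omega>. window m k \<omega> \<in> S}" for m j
    using prob_shift_power_vimage[of "{\<omega>. window m k \<omega> \<in> S}" j]
    by (simp add: window_path_shift_power sets_P sets_window)
  from this[of m "nat (m' - m)"] this[of m' "nat (m - m')"] show ?thesis
    by (cases "m \<le> m'") auto
qed

text \<open>
  A lower bound on joint probabilities excludes nontrivial invariant events, because such an event and
  its complement stay disjoint under all shifts. Suppose that \<open>E\<close> is invariant and that a cylinder \<open>C\<close> approximates it up to \<open>e\<close>. Then \<open>C\<close>
  and any translate of \<open>- C\<close> meet in measure at most \<open>2 * e\<close>, since \<open>E\<close> and \<open>- E\<close> do not meet at all.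
  The hypothesis bounds the same measure from below by nearly \<open>c * (prob E * prob (- E))\<close>. Letting
  \<open>e\<close> tend to \<open>0\<close> gives \<open>prob E * prob (- E) = 0\<close>.
\<close>

lemma ergodic_if_weakly_mixing_cylinders:
  assumes "c > 0" and mix: "\<And>N S T. \<exists>m. c * (prob (cylinder N S) * prob (cylinder N T))
      \<le> prob (cylinder N S \<inter> (path_shift ^^ m) -` cylinder N T)"
    and E [measurable]: "E \<in> events" and inv: "path_shift -` E = E"
  shows "prob E = 0 \<or> prob E = 1"
proof (rule ccontr)
  assume nontrivial: "\<not> (prob E = 0 \<or> prob E = 1)"
  define d where "d = min (prob E) (1 - prob E) / 2"
  have d: "d > 0" "2 * d \<le> prob E" "2 * d \<le> 1 - prob E"
    using nontrivial prob_le_1[of E] measure_nonneg[of P E] by (auto simp: d_def min_def less_le simp del: prob_le_1)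
  define e where "e = min d (c * d\<^sup>2 / 4)"
  have e: "e > 0" "e \<le> d" "2 * e \<le> c * d\<^sup>2 / 2" using d \<open>c > 0\<close> by (auto simp: e_def)
  obtain N S where NS: "prob (sym_diff E (cylinder N S)) < e"
    using approximable_events[OF E] e(1) unfolding approximable_def by blast
  let ?C = "cylinder N S"
  obtain m where m: "c * (prob ?C * prob (- ?C)) \<le> prob (?C \<inter> (path_shift ^^ m) -` (- ?C))"
    using mix[of N S "- S"] by (auto simp: cylinder_Compl)
  have invm: "(path_shift ^^ m) -` E = E"
  proof (induction m)
    case (Suc m)
    then show ?case using inv by (simp only: funpow.simps vimage_comp[symmetric])
  qed simp
  have sd: "sym_diff E ?C \<in> events" by measurable
  have diff: "prob (E - ?C) < e" "prob (?C - E) < e"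
    using NS finite_measure_mono[OF _ sd, of "E - ?C"] finite_measure_mono[OF _ sd, of "?C - E"] by auto
  have "?C \<inter> (path_shift ^^ m) -` (- ?C) \<subseteq> (?C - E) \<union> (path_shift ^^ m) -` (E - ?C)"
    using invm by blast
  moreover have [measurable]: "(path_shift ^^ m) -` (E - ?C) \<in> events"
    by (rule shift_power_events) measurable
  ultimately have "prob (?C \<inter> (path_shift ^^ m) -` (- ?C)) \<le> prob ((?C - E) \<union> (path_shift ^^ m) -` (E - ?C))"
    by (intro finite_measure_mono) measurable
  also have "\<dots> \<le> prob (?C - E) + prob ((path_shift ^^ m) -` (E - ?C))"
    by (rule measure_Un_le) measurable
  also have "prob ((path_shift ^^ m) -` (E - ?C)) = prob (E - ?C)"
    by (rule prob_shift_power_vimage) measurable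
  finally have upper: "c * (prob ?C * prob (- ?C)) < 2 * e" using m diff by simp
  have C [measurable]: "?C \<in> events" by measurable
  have "prob E \<le> prob ((E - ?C) \<union> ?C)" by (rule finite_measure_mono) (blast, measurable)
  also have "\<dots> \<le> prob (E - ?C) + prob ?C" by (rule measure_Un_le) measurable
  finally have 1: "d \<le> prob ?C" using diff d e by simp
  have "prob ?C \<le> prob ((?C - E) \<union> E)" by (rule finite_measure_mono) (blast, measurable)
  also have "\<dots> \<le> prob (?C - E) + prob E" by (rule measure_Un_le) measurable
  finally have 2: "d \<le> prob (- ?C)"
    using diff d e prob_compl[OF C] by (simp add: Compl_eq_Diff_UNIV)
  have "c * d\<^sup>2 \<le> c * (prob ?C * prob (- ?C))"
    using 1 2 d \<open>c > 0\<close> unfolding power2_eq_square by (intro mult_left_mono mult_mono) auto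
  with upper e have "c * d\<^sup>2 < c * d\<^sup>2 / 2" by linarith
  moreover have "c * d\<^sup>2 > 0" using d(1) \<open>c > 0\<close> by simp
  ultimately show False by linarith
qed

lemma string_prob_eq_window: "string_prob P s = prob {\<omega>. window m (length s) \<omega> = s}"
proof -
  have "string_prob P s = prob {\<omega>. window (- int (length s)) (length s) \<omega> = s}"
    by (simp add: string_prob_def past_is_window)
  then show ?thesis using prob_window_invariant[of _ "length s" "{s}"] by simp
qed

lemma prob_window_eq_sum:
  "prob {\<omega>. window m k \<omega> \<in> S} = (\<Sum>s\<in>words k. if s \<in> S then string_prob P s else 0)"
proof -
  have "prob {\<omega>. window m k \<omega> \<in> S} = prob (\<Union>s\<in>words k \<inter> S. {\<omega>. window m k \<omega> = s})"
    by (rule arg_cong[where f=prob]) auto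
  also have "\<dots> = (\<Sum>s\<in>words k \<inter> S. prob {\<omega>. window m k \<omega> = s})"
    by (rule finite_measure_finite_Union)
       (use sets_window[of m k "{_}"] in \<open>auto simp: sets_P disjoint_family_on_def\<close>)
  also have "\<dots> = (\<Sum>s\<in>words k. if s \<in> S then string_prob P s else 0)"
    by (auto simp: sum.inter_restrict string_prob_eq_window[of _ m] intro!: sum.cong)
  finally show ?thesis .
qed

lemma trans_prob_eq: "trans_prob P a s = string_prob P (s @ [a]) / string_prob P s"
proof -
  have past: "past_is s \<omega> \<longleftrightarrow> window (- int (length s)) (length s) \<omega> = s" for \<omega> :: "int \<Rightarrow> 'a"
    using past_is_window by metis
  have "(\<omega> 0 = a \<and> past_is s \<omega>) \<longleftrightarrow> window (- int (length s)) (length (s @ [a])) \<omega> = s @ [a]"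
    for \<omega> :: "int \<Rightarrow> 'a"
    unfolding past by (auto simp: window_def)
  then show ?thesis
    by (simp add: trans_prob_def cond_prob_def string_prob_eq_window[of _ "- int (length s)"] past)
qed

lemma word_law_string_prob: "word_law (string_prob P)"
proof
  fix s :: "'a list"
  show "0 \<le> string_prob P s" by (simp add: string_prob_def)
  show "string_prob P [] = 1" by (simp add: string_prob_eq_window[of _ 0] window_def prob_space[simplified])
  have sum: "(\<Sum>a\<in>UNIV. prob {\<omega>. window m k \<omega> = f a}) = prob (\<Union>a\<in>UNIV. {\<omega>. window m k \<omega> = f a})"
    if "inj f" for m k and f :: "'a \<Rightarrow> 'a list"
    by (rule finite_measure_finite_Union[symmetric])
       (use that sets_window[of m k "{_}"] in \<open>auto simp: sets_P disjoint_family_on_def inj_eq\<close>)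
  have "(\<Union>a\<in>UNIV. {\<omega>. window 0 (Suc (length s)) \<omega> = a # s}) = {\<omega>. window 1 (length s) \<omega> = s}"
    using window_infix[of "length s" 1 0 0]
    by (auto simp: window_def upt_conv_Cons map_Suc_upt[symmetric] algebra_simps o_def simp del: upt_Suc map_Suc_upt)
  with sum[of "\<lambda>a. a # s" 0 "Suc (length s)"] show "(\<Sum>a\<in>UNIV. string_prob P (a # s)) = string_prob P s"
    by (simp add: string_prob_eq_window[of _ 0, where s="_ # _"] string_prob_eq_window[of _ 1, where s=s] inj_on_def)
  have "(\<Union>a\<in>UNIV. {\<omega>. window 0 (Suc (length s)) \<omega> = s @ [a]}) = {\<omega>. window 0 (length s) \<omega> = s}"
    by (auto simp: window_def)
  with sum[of "\<lambda>a. s @ [a]" 0 "Suc (length s)"] show "(\<Sum>a\<in>UNIV. string_prob P (s @ [a])) = string_prob P s"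
    by (simp add: string_prob_eq_window[of _ 0] inj_on_def)
qed

end

lemma stationary_measure_ergodic: "P \<in> ergodic_measures \<Longrightarrow> stationary_measure P"
  by (auto simp: ergodic_measures_def stationary_measure_def stationary_measure_axioms_def
      path_measure_def path_measure_axioms_def)

context word_law
begin

lemma path_measure_process: "path_measure process"
  by (simp add: path_measure_def path_measure_axioms_def prob_space_process sets_process)

lemma stationary_process: "stationary_measure process"
proof -
  interpret path_measure process by (rule path_measure_process)
  have sets_eq: "sets process = sigma_sets UNIV (range (case_prod cylinder))"
    by (simp add: sets_process sets_path_space_eq)
  have shift: "path_shift \<in> measurable process path_space"
    using measurable_path_shift sets_process measurable_cong_sets by blast
  have "distr process path_space path_shift = process"
  proof (rule measure_eqI_generator_eq[OF Int_stable_cylinders, where A="\<lambda>_. UNIV"])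
    fix X :: "(int \<Rightarrow> 'a) set" assume "X \<in> range (case_prod cylinder)"
    then obtain N S where X: "X = cylinder N S" by auto
    have "emeasure (distr process path_space path_shift) X = emeasure process (path_shift -` X)"
      by (subst emeasure_distr[OF shift]) (auto simp: X)
    also have "path_shift -` X = {\<omega>. window (- int N + 1) (2 * N + 1) \<omega> \<in> S}"
      by (simp add: X cylinder_def window_path_shift)
    also have "emeasure process \<dots> = emeasure process X"
      by (simp add: emeasure_eq_measure measure_process_window X cylinder_def)
    finally show "emeasure (distr process path_space path_shift) X = emeasure process X" .
  next
    have "cylinder 0 UNIV = (UNIV :: (int \<Rightarrow> 'a) set)" by (simp add: cylinder_def)
    then have "case_prod cylinder (0, UNIV) = (UNIV :: (int \<Rightarrow> 'a) set)" by simp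
    then show "range (\<lambda>_. UNIV) \<subseteq> (range (case_prod cylinder) :: (int \<Rightarrow> 'a) set set)" by (metis image_subset_iff rangeI)
    show "emeasure (distr process path_space path_shift) UNIV \<noteq> \<infinity>"
      using sets.top[of path_space] by (subst emeasure_distr[OF shift]) (auto simp: emeasure_eq_measure)
  qed (auto simp: sets_eq sets_path_space_eq[symmetric])
  then show ?thesis
    by (simp add: stationary_measure_def stationary_measure_axioms_def path_measure_process)
qed

lemma string_prob_process: "string_prob process s = q s"
proof -
  interpret stationary_measure process by (rule stationary_process)
  have "string_prob process s = measure (law (length s)) {s}"
    using measure_process_window[of 0 "length s" "{s}"] by (simp add: string_prob_eq_window[of _ 0])
  then show ?thesis by (simp add: measure_pmf_single pmf_law)
qed

text \<open>
  The hypothesis is the mixing bound for two words that are separated by a gap of \<open>K\<close> free letters.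
  Summing it over the words of two cylinders gives the bound required for ergodicity.
\<close>

lemma process_ergodic:
  assumes "c > 0" and gap: "\<And>s t. c * (q s * q t) \<le> (\<Sum>g\<in>words K. q (s @ g @ t))"
  shows "process \<in> ergodic_measures"
proof -
  interpret stationary_measure process by (rule stationary_process)
  have "\<exists>m. c * (prob (cylinder N S) * prob (cylinder N T))
      \<le> prob (cylinder N S \<inter> (path_shift ^^ m) -` cylinder N T)" for N S T
  proof -
    define L where "L = 2 * N + 1"
    have "c * (prob (cylinder N S) * prob (cylinder N T)) = c * (measure (law L) S * measure (law L) T)"
      by (simp add: cylinder_def measure_process_window L_def)
    also have "\<dots> = (\<Sum>s\<in>words L. \<Sum>t\<in>words L. if s \<in> S \<and> t \<in> T then c * (q s * q t) else 0)"
      by (simp only: measure_law sum_product) (auto simp: sum_distrib_left intro!: sum.cong)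
    also have "\<dots> \<le> (\<Sum>s\<in>words L. \<Sum>t\<in>words L. \<Sum>g\<in>words K. if s \<in> S \<and> t \<in> T then q (s @ g @ t) else 0)"
      by (intro sum_mono) (use gap in auto)
    also have "\<dots> = (\<Sum>s\<in>words L. \<Sum>g\<in>words K. \<Sum>t\<in>words L. if s \<in> S \<and> t \<in> T then q (s @ g @ t) else 0)"
      by (intro sum.cong refl sum.swap)
    also have "\<dots> = measure (law (L + K + L)) {w. take L w \<in> S \<and> drop (L + K) w \<in> T}"
      unfolding measure_law sum_words_append by (intro sum.cong refl) auto
    also have "\<dots> = prob {\<omega>. window (- int N) (L + K + L) \<omega> \<in> {w. take L w \<in> S \<and> drop (L + K) w \<in> T}}"
      by (rule measure_process_window[symmetric])
    also have "{\<omega> :: int \<Rightarrow> 'a. window (- int N) (L + K + L) \<omega> \<in> {w. take L w \<in> S \<and> drop (L + K) w \<in> T}}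
        = cylinder N S \<inter> (path_shift ^^ (L + K)) -` cylinder N T"
    proof -
      have "take L (window (- int N) (L + K + L) \<omega>) = window (- int N) L \<omega>"
        "drop (L + K) (window (- int N) (L + K + L) \<omega>) = window (- int N + int (L + K)) L \<omega>"
        for \<omega> :: "int \<Rightarrow> 'a"
        using window_infix[of L 0 "- int N" "K + L" \<omega>] window_infix[of L "L + K" "- int N" 0 \<omega>]
        by (simp_all add: add.assoc)
      then show ?thesis
        unfolding cylinder_def L_def[symmetric] by (auto simp: window_path_shift_power)
    qed
    finally show ?thesis by blast
  qed
  from ergodic_if_weakly_mixing_cylinders[OF \<open>c > 0\<close> this] show ?thesis
    using shift_invariant sets_P prob_space_axioms unfolding ergodic_measures_def by blast
qed

end


section \<open>Stationary Markov chains of finite order\<close>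

text \<open>
  A stationary chain of order \<open>K\<close> is given by the law \<open>p\<close> of its words of length \<open>K + 1\<close>. The two
  marginals of \<open>p\<close> on words of length \<open>K\<close> must agree, which is the stationarity of their common value
  \<open>block\<close>.
\<close>

locale markov_law =
  fixes K :: nat and p :: "'a::finite list \<Rightarrow> real"
  assumes K_pos: "0 < K"
    and p_pos: "length w = Suc K \<Longrightarrow> 0 < p w"
    and p_total: "(\<Sum>w\<in>words (Suc K). p w) = 1"
    and p_shift: "length u = K \<Longrightarrow> (\<Sum>a\<in>UNIV. p (a # u)) = (\<Sum>a\<in>UNIV. p (u @ [a]))"
begin

definition block :: "'a list \<Rightarrow> real" where
  "block u = (\<Sum>a\<in>UNIV. p (u @ [a]))"

definition step :: "'a list \<Rightarrow> 'a \<Rightarrow> real" where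
  "step u a = p (u @ [a]) / block u"

text \<open>
  The probability that the word in the second argument comes next when the last \<open>K\<close> letters form the
  first argument.
\<close>

fun run :: "'a list \<Rightarrow> 'a list \<Rightarrow> real" where
  "run u [] = 1"
| "run u (a # t) = step u a * run (tl u @ [a]) t"

text \<open>
  The law of the chain is obtained by letting it run from a random state that precedes the word. In
  this form it covers words of every length at once, also those shorter than \<open>K\<close>.
\<close>

definition chain :: "'a list \<Rightarrow> real" where
  "chain s = (\<Sum>u\<in>words K. block u * run u s)"

lemma block_pos: "length u = K \<Longrightarrow> 0 < block u"
  unfolding block_def by (intro sum_pos p_pos) auto

lemma step_pos: "length u = K \<Longrightarrow> 0 < step u a"
  by (simp add: step_def block_pos p_pos)

lemma sum_step: "length u = K \<Longrightarrow> (\<Sum>a\<in>UNIV. step u a) = 1"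
  using block_pos[of u] unfolding step_def sum_divide_distrib[symmetric] block_def[symmetric] by simp

lemma block_step: "length u = K \<Longrightarrow> block u * step u a = p (u @ [a])"
  using block_pos[of u] by (simp add: step_def)

lemma length_next_state: "length u = K \<Longrightarrow> length (tl u @ [a]) = K"
  using K_pos by simp

lemma run_append:
  "length u = K \<Longrightarrow> run u (s @ t) = run u s * run (drop (length s) (u @ s)) t"
proof (induction s arbitrary: u)
  case (Cons a s)
  obtain b v where "u = b # v" using Cons.prems K_pos by (cases u) auto
  with Cons.prems have "run (v @ [a]) (s @ t) = run (v @ [a]) s * run (drop (length s) ((v @ [a]) @ s)) t"
    by (intro Cons.IH) simp
  with \<open>u = b # v\<close> show ?case by (simp del: drop_append)
qed simp

lemma run_lower:
  assumes "0 \<le> e" and e: "\<And>u a. length u = K \<Longrightarrow> e \<le> step u a" and "length u = K"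
  shows "e ^ length s \<le> run u s"
  using \<open>length u = K\<close>
proof (induction s arbitrary: u)
  case (Cons a s)
  have "e ^ length s \<le> run (tl u @ [a]) s" by (rule Cons.IH[OF length_next_state[OF Cons.prems]])
  then have "e * e ^ length s \<le> step u a * run (tl u @ [a]) s"
    by (rule mult_mono[OF e[OF Cons.prems]])
      (use \<open>0 \<le> e\<close> step_pos[OF Cons.prems, of a] in simp_all)
  then show ?case by simp
qed simp

lemma run_pos: "length u = K \<Longrightarrow> 0 < run u s"
  by (induction s arbitrary: u) (auto simp: step_pos K_pos)

text \<open>
  Each letter that is read pushes the oldest letter out of the state. Summing over that letter
  reproduces \<open>block\<close> by stationarity, so after reading \<open>s\<close> the state again has the stationary law,
  subject to ending in \<open>s\<close>.
\<close>

lemma chain_merge_prefix: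
  "length s \<le> K \<Longrightarrow> chain (s @ t) = (\<Sum>v\<in>words (K - length s). block (v @ s) * run (v @ s) t)"
proof (induction s arbitrary: t rule: rev_induct)
  case Nil
  then show ?case by (simp add: chain_def)
next
  case (snoc a s)
  define j where "j = K - length (s @ [a])"
  have j: "K - length s = Suc j" using snoc.prems by (simp add: j_def)
  have "chain ((s @ [a]) @ t) = (\<Sum>v\<in>words (Suc j). block (v @ s) * run (v @ s) (a # t))"
    using snoc j by simp
  also have "\<dots> = (\<Sum>v\<in>words (Suc j). p (v @ s @ [a]) * run (tl (v @ s) @ [a]) t)"
    using j snoc.prems block_step[of "_ @ s" a] by (intro sum.cong refl) simp
  also have "\<dots> = (\<Sum>v\<in>words j. \<Sum>b\<in>UNIV. p (b # v @ s @ [a]) * run (v @ s @ [a]) t)"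
    by (simp add: sum_words_Cons sum.swap[of _ UNIV])
  also have "\<dots> = (\<Sum>v\<in>words j. block (v @ s @ [a]) * run (v @ s @ [a]) t)"
    unfolding sum_distrib_right[symmetric]
    using snoc.prems by (intro sum.cong refl) (simp add: p_shift block_def j_def)
  finally show ?case by (simp add: j_def)
qed

lemma chain_block_append: "length u = K \<Longrightarrow> chain (u @ t) = block u * run u t"
  using chain_merge_prefix[of u t] by simp

lemma word_law_chain: "word_law chain"
proof
  fix s :: "'a list"
  show "0 \<le> chain s"
    unfolding chain_def by (intro sum_nonneg) (simp add: block_pos run_pos less_imp_le)
  show "chain [] = 1"
    using p_total by (simp add: chain_def block_def sum_words_snoc)
  have "(\<Sum>a\<in>UNIV. run u (s @ [a])) = run u s" if "length u = K" for u
    using that by (simp add: run_append sum_distrib_left[symmetric] sum_step)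
  then show "(\<Sum>a\<in>UNIV. chain (s @ [a])) = chain s"
    unfolding chain_def by (subst sum.swap) (simp add: sum_distrib_left[symmetric])
  obtain j where j: "K = Suc j" using K_pos by (cases K) auto
  have "(\<Sum>a\<in>UNIV. chain (a # s)) = (\<Sum>a\<in>UNIV. \<Sum>v\<in>words j. block (v @ [a]) * run (v @ [a]) s)"
    using chain_merge_prefix[of "[_]" s] by (simp add: j)
  also have "\<dots> = chain s"
    unfolding chain_def by (subst sum.swap) (simp add: j sum_words_snoc)
  finally show "(\<Sum>a\<in>UNIV. chain (a # s)) = chain s" .
qed

sublocale word_law chain by (rule word_law_chain)

lemma chain_pos: "0 < chain s"
proof -
  have "words K \<noteq> ({} :: 'a list set)" by (auto intro: exI[of _ "replicate K undefined"])
  then show ?thesis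
    unfolding chain_def by (intro sum_pos) (auto simp: block_pos run_pos)
qed

lemma chain_Markov: "length u = K \<Longrightarrow> chain ((x @ u) @ [a]) = chain (x @ u) * step u a"
  unfolding chain_def sum_distrib_right
proof (intro sum.cong refl)
  fix v :: "'a list" assume "length u = K" "v \<in> words K"
  then have "run v ((x @ u) @ [a]) = run v (x @ u) * step u a"
    by (subst run_append) auto
  then show "block v * run v ((x @ u) @ [a]) = block v * run v (x @ u) * step u a" by simp
qed

text \<open>
  A gap of \<open>K\<close> letters is filled with any given word \<open>g\<close> with conditional probability at least
  \<open>e ^ K\<close>, where \<open>e\<close> is the least transition probability. After the gap the state is \<open>g\<close>, and \<open>s\<close> no
  longer matters. Since \<open>block g \<le> 1\<close>, this dominates \<open>e ^ K\<close> times the situation in which \<open>g\<close> is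
  drawn afresh from the stationary law.
\<close>

lemma chain_gap: "\<exists>c>0. \<forall>s t. c * (chain s * chain t) \<le> (\<Sum>g\<in>words K. chain (s @ g @ t))"
proof -
  define E where "E = (\<lambda>(u, a). step u a) ` (words K \<times> UNIV)"
  have "words K \<noteq> ({} :: 'a list set)" by (auto intro: exI[of _ "replicate K undefined"])
  then have E: "finite E" "E \<noteq> {}" by (auto simp: E_def)
  define e where "e = Min E"
  have "e \<in> E" using E by (simp add: e_def)
  then obtain u\<^sub>0 a\<^sub>0 where "e = step u\<^sub>0 a\<^sub>0" "length u\<^sub>0 = K" unfolding E_def by force
  then have "0 < e" by (simp only: step_pos)
  have e: "e \<le> step u a" if "length u = K" for u a
    unfolding e_def
  proof (rule Min_le[OF E(1)])
    show "step u a \<in> E" unfolding E_def using that by force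
  qed
  have "e ^ K * (chain s * chain t) \<le> (\<Sum>g\<in>words K. chain (s @ g @ t))" for s t
  proof -
    have "e ^ K * (chain s * chain t) = (\<Sum>g\<in>words K. (e ^ K * chain s) * (block g * run g t))"
      by (simp add: chain_def[of t] sum_distrib_left mult.assoc)
    also have "\<dots> \<le> (\<Sum>g\<in>words K. chain (s @ g @ t))"
    proof (intro sum_mono)
      fix g :: "'a list" assume "g \<in> words K"
      then have g: "length g = K" by simp
      have "block g \<le> 1" using le_1[of g] chain_block_append[OF g, of "[]"] by (simp only: append_Nil2 run.simps mult_1_right)
      then have "(e ^ K * chain s) * (block g * run g t) \<le> (e ^ K * chain s) * (1 * run g t)"
        using run_pos[OF g, of t] \<open>0 < e\<close> nonneg[of s] by (intro mult_left_mono mult_right_mono) simp_all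
      also have "\<dots> = (\<Sum>u\<in>words K. block u * (run u s * e ^ K * run g t))"
        unfolding chain_def sum_distrib_left sum_distrib_right by (intro sum.cong refl) (simp add: mult_ac)
      also have "\<dots> \<le> (\<Sum>u\<in>words K. block u * run u (s @ g @ t))"
      proof (intro sum_mono mult_left_mono)
        fix u :: "'a list" assume "u \<in> words K"
        then have u: "length u = K" by simp
        have "run u (s @ g @ t) = run u s * run (drop (length s) (u @ s)) g * run g t"
          using run_append[OF u, of "s @ g" t] run_append[OF u, of s g] u g by simp
        moreover have "e ^ K \<le> run (drop (length s) (u @ s)) g"
          using run_lower[OF less_imp_le[OF \<open>0 < e\<close>] e, of "drop (length s) (u @ s)" g] u g by simp
        ultimately show "run u s * e ^ K * run g t \<le> run u (s @ g @ t)"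
          using run_pos[OF u, of s] run_pos[OF g, of t]
          by (metis less_imp_le mult_left_mono mult_right_mono)
        show "0 \<le> block u" using block_pos[OF u] by simp
      qed
      finally show "(e ^ K * chain s) * (block g * run g t) \<le> chain (s @ g @ t)"
        by (simp add: chain_def)
    qed
    finally show ?thesis .
  qed
  then show ?thesis using \<open>0 < e\<close> by (intro exI[of _ "e ^ K"]) simp
qed

lemma process_in_ergodic_measures: "process \<in> ergodic_measures"
proof -
  obtain c where "0 < c" "\<And>s t. c * (chain s * chain t) \<le> (\<Sum>g\<in>words K. chain (s @ g @ t))"
    using chain_gap by metis
  then show ?thesis by (rule process_ergodic)
qed

lemma trans_prob_process: "trans_prob process a s = chain (s @ [a]) / chain s"
proof -
  interpret stationary_measure process by (rule stationary_process)
  show ?thesis by (simp add: trans_prob_eq string_prob_process)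
qed

lemma trans_prob_long: "length u = K \<Longrightarrow> trans_prob process a (x @ u) = step u a"
  using chain_pos[of "x @ u"] unfolding trans_prob_process by (subst chain_Markov) auto

lemma memory_suffices_long:
  assumes "K \<le> length s" shows "memory_suffices process s"
proof -
  define u where "u = drop (length s - K) s"
  define x where "x = take (length s - K) s"
  have u: "length u = K" and s: "s = x @ u" using assms by (auto simp: u_def x_def)
  show ?thesis
    unfolding memory_suffices_def
  proof (intro allI impI)
    fix a v assume "suffix s v"
    then obtain y where "v = (y @ x) @ u" by (auto simp: suffix_def s)
    then show "trans_prob process a v = trans_prob process a s"
      unfolding s by (simp only: trans_prob_long[OF u])
  qed
qed

end

text \<open>
  The oldest letter of the memory is relevant for every choice of the other \<open>K - 1\<close> letters. This
  makes all words of length \<open>K\<close>, and only these, contexts.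
\<close>

locale branching_markov_law = markov_law +
  assumes branching: "Suc (length u) = K \<Longrightarrow> \<exists>a b c. step (b # u) a \<noteq> step (c # u) a"
begin

text \<open>
  A word \<open>s\<close> shorter than \<open>K\<close> has an extension \<open>u\<close> of length \<open>K - 1\<close>. If \<open>s\<close> sufficed, then the
  transition probabilities from \<open>b # u\<close> would be the same for all letters \<open>b\<close>.
\<close>

lemma memory_suffices_iff: "memory_suffices process s \<longleftrightarrow> K \<le> length s"
proof
  assume suff: "memory_suffices process s"
  show "K \<le> length s"
  proof (rule ccontr)
    assume "\<not> K \<le> length s"
    define u where "u = replicate (K - Suc (length s)) undefined @ s"
    have u: "Suc (length u) = K" using \<open>\<not> K \<le> length s\<close> by (simp add: u_def)
    have "step (b # u) a = trans_prob process a s" for a b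
    proof -
      have "suffix s (b # u)" by (auto simp: u_def suffix_def intro!: exI[of _ "b # _"])
      then have "trans_prob process a (b # u) = trans_prob process a s"
        using suff chain_pos[of "b # u"] unfolding memory_suffices_def string_prob_process by blast
      moreover have "trans_prob process a (b # u) = step (b # u) a"
        using trans_prob_long[of "b # u" a "[]"] u by simp
      ultimately show ?thesis by simp
    qed
    with branching[OF u] show False by simp
  qed
qed (rule memory_suffices_long)

lemma finite_context_iff: "finite_context process s \<longleftrightarrow> length s = K"
proof
  assume *: "finite_context process s"
  then have "K \<le> length s" by (simp add: finite_context_def memory_suffices_iff)
  moreover have "\<not> K < length s"
  proof
    assume "K < length s"
    then have "strict_suffix (drop (length s - K) s) s" and "length (drop (length s - K) s) = K"
      using suffix_drop[of "length s - K" s] by (auto simp: strict_suffix_def dest: arg_cong[where f=length])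
    with * show False by (auto simp: finite_context_def memory_suffices_iff)
  qed
  ultimately show "length s = K" by simp
next
  assume "length s = K"
  then show "finite_context process s"
    by (auto simp: finite_context_def memory_suffices_iff string_prob_process chain_pos
        dest!: suffix_length_less)
qed

lemma context_tree_process: "context_tree process = Fin ` words K"
proof -
  have "\<not> infinite_context process x" for x
  proof
    assume *: "infinite_context process x"
    have "lsuffix (rev (map x [0..<K])) (LInf x)" by (simp add: lsuffix_LInf)
    with * have "length (rev (map x [0..<K])) \<noteq> K"
      unfolding infinite_context_def finite_context_iff by blast
    then show False by simp
  qed
  then show ?thesis by (auto simp: context_tree_def finite_context_iff)
qed

lemma nodes_context_tree_process: "nodes (context_tree process) = {w. length w \<le> K}"
proof -
  have "\<exists>s\<in>words K. suffix w s" if "length w \<le> K" for w :: "'a list"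
    using that by (intro bexI[of _ "replicate (K - length w) undefined @ w"]) (auto simp: suffix_def)
  then show ?thesis
    by (auto simp: nodes_def context_tree_process dest: suffix_length_le)
qed

lemma process_in_finite_memory_measures: "process \<in> finite_memory_measures"
  by (auto simp: finite_memory_measures_def process_in_ergodic_measures finite_tree_def context_tree_process)

end

section \<open>Branching chains close to a given law\<close>

lemma two_distinct:
  assumes "CARD('a) \<ge> 2" obtains x y :: "'a::finite" where "x \<noteq> y"
  using assms by (metis card_2_iff' card_le_Suc0_iff_eq finite iso_tuple_UNIV_I not_less_eq_eq numeral_2_eq_2)

context word_law
begin

text \<open>
  The order-\<open>K\<close> chain with the same words of length \<open>K + 1\<close> as \<open>q\<close> need not be branching, for instance
  if \<open>q\<close> is the law of independent letters. Where it is not, the law of the words \<open>b # u @ [a]\<close> is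
  perturbed by a multiple of \<open>f b * f a\<close>, where \<open>f\<close> has sum \<open>0\<close> over the alphabet. Both marginals on
  words of length \<open>K\<close> are left untouched, so that the result is again stationary and still agrees
  with \<open>q\<close> on words of length at most \<open>K\<close>.
\<close>

lemma ex_branching_markov_law:
  assumes pos: "\<And>s. 0 < q s" and "CARD('a) \<ge> 2" "0 < K"
  shows "\<exists>p. branching_markov_law K p \<and> (\<forall>u. length u = K \<longrightarrow> (\<Sum>a\<in>UNIV. p (u @ [a])) = q u)"
proof -
  obtain x y :: 'a where xy: "x \<noteq> y" using two_distinct assms(2) by blast
  define f :: "'a \<Rightarrow> real" where "f a = (if a = x then 1 else if a = y then -1 else 0)" for a
  have sum_f: "(\<Sum>a\<in>UNIV. f a) = 0"
  proof -
    have "(\<Sum>a\<in>UNIV. f a) = (\<Sum>a\<in>{x, y}. f a)"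
      by (rule sum.mono_neutral_right) (auto simp: f_def)
    then show ?thesis using xy by (simp add: f_def)
  qed
  \<comment> \<open>Half the least probability of a word of length \<open>K + 1\<close>, so that the perturbation keeps all of them positive.\<close>
  define h where "h = Min (q ` words (Suc K)) / 2"
  have ne: "words (Suc K) \<noteq> ({} :: 'a list set)" by (auto intro: exI[of _ "replicate (Suc K) undefined"])
  have "Min (q ` words (Suc K)) \<in> q ` words (Suc K)" using ne by (intro Min_in) auto
  then have "0 < h" using pos by (auto simp: h_def)
  have h: "h < q w" if "length w = Suc K" for w
  proof -
    have "2 * h \<le> q w" unfolding h_def using that by (auto intro!: Min_le)
    with \<open>0 < h\<close> show ?thesis by linarith
  qed
  \<comment> \<open>Under \<open>q\<close> the condition says that \<open>x # u\<close> and \<open>y # u\<close> are followed by \<open>x\<close> with the same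
    conditional probability: only then is a perturbation needed, and it may spoil the inequality otherwise.\<close>
  define \<eta> where "\<eta> u = (if q (x # u @ [x]) * q (y # u) = q (y # u @ [x]) * q (x # u) then h else 0)" for u
  define p where "p w = q w + \<eta> (butlast (tl w)) * f (hd w) * f (last w)" for w
  have p_sandwich: "p (b # u @ [a]) = q (b # u @ [a]) + \<eta> u * f b * f a" for a b u
    by (simp add: p_def)
  have snoc: "(\<Sum>a\<in>UNIV. p (u @ [a])) = q u" if "length u = K" for u
  proof -
    have "u \<noteq> []" using that \<open>0 < K\<close> by auto
    then obtain b v where u: "u = b # v" by (meson neq_Nil_conv)
    have "(\<Sum>a\<in>UNIV. p (b # v @ [a])) = q (b # v) + \<eta> v * f b * (\<Sum>a\<in>UNIV. f a)"
      using sum_snoc[of "b # v"] by (simp add: p_sandwich sum.distrib sum_distrib_left)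
    then show ?thesis by (simp add: sum_f u)
  qed
  have Cons: "(\<Sum>a\<in>UNIV. p (a # u)) = q u" if "length u = K" for u
  proof -
    have "u \<noteq> []" using that \<open>0 < K\<close> by auto
    then obtain b v where u: "u = v @ [b]" by (meson rev_exhaust)
    have "(\<Sum>a\<in>UNIV. p (a # v @ [b])) = q (v @ [b]) + \<eta> v * f b * (\<Sum>a\<in>UNIV. f a)"
      using sum_Cons[of "v @ [b]"] by (simp add: p_sandwich sum.distrib sum_distrib_left mult_ac)
    then show ?thesis by (simp add: sum_f u)
  qed
  interpret p: markov_law K p
  proof
    show "0 < K" by fact
    show "0 < p w" if "length w = Suc K" for w
    proof -
      have "\<bar>\<eta> (butlast (tl w)) * f (hd w) * f (last w)\<bar> \<le> h"
        using \<open>0 < h\<close> by (simp add: \<eta>_def f_def abs_mult)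
      then show ?thesis using h[OF that] by (simp add: p_def)
    qed
    show "(\<Sum>w\<in>words (Suc K). p w) = 1"
      by (simp add: sum_words_snoc snoc sum_words_eq_1)
  qed (simp add: snoc Cons)
  have "branching_markov_law K p"
  proof
    fix u :: "'a list" assume u: "Suc (length u) = K"
    have "p (x # u @ [x]) * q (y # u) \<noteq> p (y # u @ [x]) * q (x # u)"
    proof (cases "\<eta> u = 0")
      case True
      then show ?thesis using \<open>0 < h\<close> by (auto simp: p_sandwich \<eta>_def split: if_splits)
    next
      case False
      then have eq: "q (x # u @ [x]) * q (y # u) = q (y # u @ [x]) * q (x # u)" and "\<eta> u = h"
        by (auto simp: \<eta>_def split: if_splits)
      have "p (x # u @ [x]) * q (y # u) - p (y # u @ [x]) * q (x # u) = h * (q (x # u) + q (y # u))"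
        using eq xy by (simp add: p_sandwich \<open>\<eta> u = h\<close> f_def algebra_simps)
      moreover have "h * (q (x # u) + q (y # u)) > 0" using \<open>0 < h\<close> pos by (simp add: add_pos_pos)
      ultimately show ?thesis by linarith
    qed
    moreover have "p.block (b # u) = q (b # u)" for b using snoc[of "b # u"] u by (simp add: p.block_def)
    ultimately have "p.step (x # u) x \<noteq> p.step (y # u) x"
      using pos[of "x # u"] pos[of "y # u"] by (simp add: p.step_def frac_eq_eq)
    then show "\<exists>a b c. p.step (b # u) a \<noteq> p.step (c # u) a" by blast
  qed
  then show ?thesis using snoc by blast
qed

lemma ex_process_with_full_context_tree:
  assumes pos: "\<And>s. 0 < q s" and "CARD('a) \<ge> 2" "0 < K"
  shows "\<exists>Q\<in>finite_memory_measures. nodes (context_tree Q) = {w. length w \<le> K}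
           \<and> (\<forall>s. length s \<le> K \<longrightarrow> string_prob Q s = q s)"
proof -
  obtain p where "branching_markov_law K p"
      and marg: "\<And>u. length u = K \<Longrightarrow> (\<Sum>a\<in>UNIV. p (u @ [a])) = q u"
    using ex_branching_markov_law[OF assms] by blast
  then interpret p: branching_markov_law K p by simp
  have "p.chain s = q s" if "length s \<le> K" for s
    using p.chain_merge_prefix[OF that, of "[]"] that
    by (simp add: p.block_def marg sum_prepend append_assoc[symmetric] del: append_assoc)
  then show ?thesis
    using p.process_in_finite_memory_measures p.nodes_context_tree_process
    by (intro bexI[of _ p.process]) (auto simp: p.string_prob_process)
qed

end

lemma word_law_uniform: "word_law (\<lambda>s :: 'a::finite list. (1 / real CARD('a)) ^ length s)"
  by unfold_locales auto

lemma word_law_mixture: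
  assumes "word_law q" "word_law r" "0 \<le> d" "d \<le> 1"
  shows "word_law (\<lambda>s. (1 - d) * q s + d * r s)"
proof -
  interpret q: word_law q by fact
  interpret r: word_law r by fact
  show ?thesis
    by unfold_locales
      (use assms(3,4) in \<open>simp_all add: q.nonneg r.nonneg sum.distrib sum_distrib_left[symmetric]
          q.sum_Cons r.sum_Cons q.sum_snoc r.sum_snoc\<close>)
qed

section \<open>No statistic bounds the context tree from above\<close>

text \<open>
  Every sample whose tree is not full misses some string, and there are only finitely many samples.
  A chain whose context tree is the full tree of large depth therefore has nodes outside the
  estimated tree on all of these samples at once.
\<close>

theorem theorem2p10:
  fixes U :: "'a::finite list \<Rightarrow> 'a lstring set" and n :: nat
  assumes "CARD('a) \<ge> 2"
    and "n \<ge> 1"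
    and "U \<in> {xs. length xs = n} \<rightarrow> irreducible_trees"
    and "(SUP P \<in> ergodic_measures. \<P>(\<omega> in P. U (map \<omega> [1..int n]) \<prec>\<^sub>T full_tree)) = 1"
  shows "(INF P \<in> ergodic_measures. \<P>(\<omega> in P. context_tree P \<preceq>\<^sub>T U (map \<omega> [1..int n]))) = 0
    \<and> (INF P \<in> finite_memory_measures. \<P>(\<omega> in P. context_tree P \<preceq>\<^sub>T U (map \<omega> [1..int n]))) = 0"
proof -
  let ?F = "\<lambda>P. \<P>(\<omega> in P. context_tree P \<preceq>\<^sub>T U (map \<omega> [1..int n]))"
  have sample: "\<P>(\<omega> in P. R (map \<omega> [1..int n])) = (\<Sum>s\<in>words n. if R s then string_prob P s else 0)"
    if "P \<in> ergodic_measures" for P and R :: "'a list \<Rightarrow> bool"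
  proof -
    interpret stationary_measure P using that by (rule stationary_measure_ergodic)
    show ?thesis using prob_window_eq_sum[of 1 n "Collect R"] by (simp add: map_upto_window)
  qed
  have ergodic: "P \<in> ergodic_measures" if "P \<in> finite_memory_measures" for P :: "(int \<Rightarrow> 'a) measure"
    using that by (simp add: finite_memory_measures_def)
  interpret unif: word_law "\<lambda>s :: 'a list. (1 / real CARD('a)) ^ length s" by (rule word_law_uniform)
  have unif_pos: "0 < (1 / real CARD('a)) ^ length s" for s :: "'a list" by simp
  have nonempty: "finite_memory_measures \<noteq> ({} :: (int \<Rightarrow> 'a) measure set)"
    using unif.ex_process_with_full_context_tree[OF unif_pos assms(1), of 1] by auto
  then have ergodic_nonempty: "ergodic_measures \<noteq> ({} :: (int \<Rightarrow> 'a) measure set)"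
    using ergodic by blast
  have small: "\<exists>Q\<in>finite_memory_measures. ?F Q < e" if "e > 0" for e
  proof -
    \<comment> \<open>The final bound is \<open>1 - (1 - d) * (1 - d)\<close>, which is less than \<open>2 * d\<close>.\<close>
    define d where "d = min (1 / 2) (e / 3)"
    have d: "0 < d" "d < 1" "2 * d < e" using \<open>e > 0\<close> by (auto simp: d_def min_def)
    define B where "B = {s. U s \<prec>\<^sub>T full_tree}"
    have "bdd_above ((\<lambda>P. \<P>(\<omega> in P. U (map \<omega> [1..int n]) \<prec>\<^sub>T full_tree)) ` ergodic_measures)"
      by (rule bdd_aboveI2[of _ _ 1]) (auto simp: ergodic_measures_def prob_space.prob_le_1)
    then obtain P where P: "P \<in> ergodic_measures"
        "1 - d < \<P>(\<omega> in P. U (map \<omega> [1..int n]) \<prec>\<^sub>T full_tree)"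
      using assms(4) d(1) ergodic_nonempty less_cSUP_iff[of ergodic_measures _ "1 - d"] by fastforce
    interpret P: stationary_measure P using P(1) by (rule stationary_measure_ergodic)
    interpret P_law: word_law "string_prob P" by (rule P.word_law_string_prob)
    \<comment> \<open>The uniform part makes all words possible, as the existence of a branching chain requires.\<close>
    define b where "b s = (1 - d) * string_prob P s + d * (1 / real CARD('a)) ^ length s" for s
    have b_pos: "0 < b s" for s
      using P_law.nonneg[of s] d by (auto simp: b_def intro!: add_nonneg_pos)
    interpret b: word_law b
      unfolding b_def[abs_def]
      using d by (intro word_law_mixture P.word_law_string_prob word_law_uniform) auto
    have "\<forall>s\<in>B. \<exists>w. w \<notin> nodes (U s)"
      by (auto simp: B_def tree_less_def nodes_full_tree)
    then obtain w where w: "\<And>s. s \<in> B \<Longrightarrow> w s \<notin> nodes (U s)" by metis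
    \<comment> \<open>The order is large enough for the chain to have law \<open>b\<close> on the sample and for its tree to contain all the missed strings.\<close>
    define K where "K = Suc (n + (\<Sum>s\<in>words n. length (w s)))"
    have wK: "length (w s) \<le> K" if "length s = n" for s
      using member_le_sum[of s "words n" "\<lambda>s. length (w s)"] that by (simp add: K_def)
    obtain Q where Q: "Q \<in> finite_memory_measures" "nodes (context_tree Q) = {w. length w \<le> K}"
        "\<And>s. length s \<le> K \<Longrightarrow> string_prob Q s = b s"
      using b.ex_process_with_full_context_tree[OF b_pos assms(1), of K] by (auto simp: K_def)
    have missed: "\<not> context_tree Q \<preceq>\<^sub>T U s" if "s \<in> B" "length s = n" for s
      using w[OF that(1)] wK[OF that(2)] by (auto simp: tree_le_def Q(2))
    have "?F Q = (\<Sum>s\<in>words n. if context_tree Q \<preceq>\<^sub>T U s then string_prob Q s else 0)"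
      by (rule sample[OF ergodic[OF Q(1)]])
    also have "\<dots> \<le> (\<Sum>s\<in>words n. b s - (if s \<in> B then (1 - d) * string_prob P s else 0))"
      using missed b.nonneg d by (intro sum_mono) (auto simp: Q(3) K_def b_def)
    also have "\<dots> = 1 - (1 - d) * (\<Sum>s\<in>words n. if s \<in> B then string_prob P s else 0)"
      by (simp add: sum_subtractf b.sum_words_eq_1 sum_distrib_left if_distrib[of "(*) _"] cong: if_cong)
    also have "\<dots> \<le> 1 - (1 - d) * (1 - d)"
      using P(2) d unfolding sample[OF P(1), of "\<lambda>s. U s \<prec>\<^sub>T full_tree"] by (simp add: B_def)
    also have "\<dots> < e" using d by (simp add: algebra_simps) (smt (verit) mult_pos_pos)
    finally show ?thesis using Q(1) by blast
  qed
  have bdd: "bdd_below (?F ` M)" for M by (rule bdd_belowI2[of _ 0]) simp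
  have INF_zero: "(INF P\<in>M. ?F P) = 0" if "finite_memory_measures \<subseteq> M" for M
  proof (rule antisym)
    show "0 \<le> (INF P\<in>M. ?F P)"
      using nonempty that by (intro cINF_greatest) auto
    show "(INF P\<in>M. ?F P) \<le> 0"
    proof (rule field_le_epsilon)
      fix e :: real assume "e > 0"
      then obtain Q where "Q \<in> finite_memory_measures" "?F Q < e" using small by blast
      then show "(INF P\<in>M. ?F P) \<le> 0 + e"
        using cINF_lower[OF bdd, of Q M] that by fastforce
    qed
  qed
  show ?thesis using INF_zero ergodic by blast
qed

end
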